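(* Consider a periodic sampling schedule characterized by the intervals $\mathcal{T}=(\tau_0,\dots,\tau_{j-1})$ (positive integers), and let $\bar\tau=\max\{\tau_i: i\in\{0,1,\dots,j-1\}\}$. Then $$\gamma_{\mathcal{T}}=\gamma_{\bar\tau},$$ where $\gamma_{\mathcal{T}}$ is the $h_\infty$ norm for the schedule $\mathcal{T}$ and $\gamma_{\bar\tau}$ is the $h_\infty$ norm for evenly spaced sampling with interval $\bar\tau$.
   Context: System: $x_{t+1}=Ax_t+Bu_t+w_t$, $t\in\mathbb{N}_0$, with output $z_t=C_2x_t+D_{21}u_t$, where $x_t,w_t\in\mathbb{R}^{n_x}$, $u_t\in\mathbb{R}^{n_u}$, $C_2^\top D_{21}=0$, $Q:=C_2^\top C_2$, $R:=D_{21}^\top D_{21}>0$, $(A,B)$ controllable and $(A,C_2)$ observable. Schedule: a tuple $\mathcal{T}=(\tau_0,\dots,\tau_{j-1})$ of positive integers is extended periodically by $\tau_{\ell+j}=\tau_\ell$; the sampling times are $s_0=0$, $s_{\ell+1}=s_\ell+\tau_\ell$; $\sigma_t=1$ if $t$ is a sampling time and $\sigma_t=0$ otherwise. At time $t$ the controller knows $\mathcal{J}_t=\{x_r: 0\le r\le t,\ \sigma_r=1\}$, and a control policy $\pi_u$ is a sequence of functions $\mu_{u,t}$ with $u_t=\mu_{u,t}(\mathcal{J}_t)$. Evenly spaced sampling with interval $h\in\mathbb{N}$ is the schedule with all intervals equal to $h$. $h_\infty$ norm: for sequences, $\|w\|^2=\sum_{t\ge0}w_t^\top w_t$, and $\ell_2$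 is the space of sequences with finite norm. An attenuation bound $\gamma>0$ is achieved by $\pi_u$ if, with $x_0=0$, $\|z\|^2\le\gamma^2\|w\|^2$ for all $w\in\ell_2$. Then $\gamma_{\mathcal{T}}:=\inf\{\gamma:\ \text{there is } \pi_u \text{ achieving the attenuation bound } \gamma \text{ under schedule } \mathcal{T}\}$, and $\gamma_h$ denotes this quantity for evenly spaced sampling with interval $h$. *)

theory Defs
  imports "HOL-Analysis.Analysis" "HOL-Library.Extended_Real"
begin

section \<open>Linear systems\<close>

primrec open_loop_state ::
  "real^'n^'n \<Rightarrow> real^'m^'n \<Rightarrow> (nat \<Rightarrow> real^'m) \<Rightarrow> real^'n \<Rightarrow> nat \<Rightarrow> real^'n" where
  "open_loop_state A B u x0 0 = x0"
| "open_loop_state A B u x0 (Suc t) = A *v open_loop_state A B u x0 t + B *v u t"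

definition controllable :: "real^'n^'n \<Rightarrow> real^'m^'n \<Rightarrow> bool" where
  "controllable A B \<longleftrightarrow> (\<forall>x0 x1. \<exists>N u. open_loop_state A B u x0 N = x1)"

text \<open>Observability of the pair: the output of the autonomous system determines the initial
  state.  Powers of \<open>A\<close> are iterates of \<open>(*v) A\<close>, because \<open>A ^ t\<close> on the vector type is the
  componentwise power.\<close>

definition observable :: "real^'n^'n \<Rightarrow> real^'n^'p \<Rightarrow> bool" where
  "observable A C \<longleftrightarrow>
     (\<forall>x0 x1. (\<forall>t. C *v ((*v) A ^^ t) x0 = C *v ((*v) A ^^ t) x1) \<longrightarrow> x0 = x1)"

definition positive_definite :: "real^'m^'m \<Rightarrow> bool" where
  "positive_definite R \<longleftrightarrow> transpose R = R \<and> (\<forall>v. v \<noteq> 0 \<longrightarrow> v \<bullet> (R *v v) > 0)"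

section \<open>Sampling schedules\<close>

text \<open>A list \<open>ts\<close> of intervals stands for its periodic extension.\<close>

definition schedule :: "nat list \<Rightarrow> bool" where
  "schedule ts \<longleftrightarrow> ts \<noteq> [] \<and> (\<forall>\<tau>\<in>set ts. \<tau> > 0)"

definition interval :: "nat list \<Rightarrow> nat \<Rightarrow> nat" where
  "interval ts l = ts ! (l mod length ts)"

definition sampling_time :: "nat list \<Rightarrow> nat \<Rightarrow> nat" where
  "sampling_time ts l = (\<Sum>i<l. interval ts i)"

definition sampled :: "nat list \<Rightarrow> nat \<Rightarrow> bool" where
  "sampled ts t \<longleftrightarrow> t \<in> range (sampling_time ts)"

section \<open>Control policies and the closed loop\<close>

text \<open>The information \<open>{x r | r \<le> t, r a sampling time}\<close> is kept as a family indexed by time,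
  that is, as a partial map defined exactly at the sampling times up to \<open>t\<close>.\<close>

definition information :: "nat list \<Rightarrow> (nat \<Rightarrow> 'x) \<Rightarrow> nat \<Rightarrow> (nat \<rightharpoonup> 'x)" where
  "information ts x t = (\<lambda>r. if r \<le> t \<and> sampled ts r then Some (x r) else None)"

type_synonym ('n, 'm) policy = "nat \<Rightarrow> (nat \<rightharpoonup> real^'n) \<Rightarrow> real^'m"

lemma information_cong [fundef_cong]:
  assumes "ts = ts'" "t = t'" "\<And>r. r \<le> t' \<Longrightarrow> x r = y r"
  shows "information ts x t = information ts' y t'"
  using assms by (auto simp: information_def fun_eq_iff)

fun state ::
  "real^'n^'n \<Rightarrow> real^'m^'n \<Rightarrow> nat list \<Rightarrow> ('n, 'm) policy \<Rightarrow> (nat \<Rightarrow> real^'n) \<Rightarrow> nat \<Rightarrow> real^'n"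
where
  "state A B ts \<mu> w 0 = 0"
| "state A B ts \<mu> w (Suc t) =
     A *v state A B ts \<mu> w t + B *v \<mu> t (information ts (\<lambda>r. state A B ts \<mu> w r) t) + w t"

definition control ::
  "real^'n^'n \<Rightarrow> real^'m^'n \<Rightarrow> nat list \<Rightarrow> ('n, 'm) policy \<Rightarrow> (nat \<Rightarrow> real^'n) \<Rightarrow> nat \<Rightarrow> real^'m"
where
  "control A B ts \<mu> w t = \<mu> t (information ts (state A B ts \<mu> w) t)"

definition controlled_output ::
  "real^'n^'n \<Rightarrow> real^'m^'n \<Rightarrow> real^'n^'p \<Rightarrow> real^'m^'p \<Rightarrow> nat list \<Rightarrow> ('n, 'm) policy \<Rightarrow>
    (nat \<Rightarrow> real^'n) \<Rightarrow> nat \<Rightarrow> real^'p"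
where
  "controlled_output A B C D ts \<mu> w t = C *v state A B ts \<mu> w t + D *v control A B ts \<mu> w t"

section \<open>The \<open>h\<^sub>\<infinity>\<close> norm\<close>

definition l2 :: "(nat \<Rightarrow> 'a::real_inner) set" where
  "l2 = {w. summable (\<lambda>t. w t \<bullet> w t)}"

definition l2_norm_sq :: "(nat \<Rightarrow> 'a::real_inner) \<Rightarrow> real" where
  "l2_norm_sq w = (\<Sum>t. w t \<bullet> w t)"

text \<open>Membership of the output in \<open>l2\<close> is required explicitly, since \<open>suminf\<close> has no
  meaningful value on a divergent series (where the norm is infinite).\<close>

definition achieves_bound ::
  "real^'n^'n \<Rightarrow> real^'m^'n \<Rightarrow> real^'n^'p \<Rightarrow> real^'m^'p \<Rightarrow> nat list \<Rightarrow> ('n, 'm) policy \<Rightarrow>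
    real \<Rightarrow> bool"
where
  "achieves_bound A B C D ts \<mu> \<gamma> \<longleftrightarrow>
     (\<forall>w\<in>l2. controlled_output A B C D ts \<mu> w \<in> l2 \<and>
             l2_norm_sq (controlled_output A B C D ts \<mu> w) \<le> \<gamma>\<^sup>2 * l2_norm_sq w)"

text \<open>Taken in \<^typ>\<open>ereal\<close>, so that the infimum would be \<open>\<infinity>\<close> if no bound were achievable.\<close>

definition h_inf_norm ::
  "real^'n^'n \<Rightarrow> real^'m^'n \<Rightarrow> real^'n^'p \<Rightarrow> real^'m^'p \<Rightarrow> nat list \<Rightarrow> ereal"
where
  "h_inf_norm A B C D ts =
     Inf {ereal \<gamma> | \<gamma>. \<gamma> > 0 \<and> (\<exists>\<mu>. achieves_bound A B C D ts \<mu> \<gamma>)}"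

definition h_inf_norm_even ::
  "real^'n^'n \<Rightarrow> real^'m^'n \<Rightarrow> real^'n^'p \<Rightarrow> real^'m^'p \<Rightarrow> nat \<Rightarrow> ereal"
where
  "h_inf_norm_even A B C D h = h_inf_norm A B C D [h]"

end

theory Submission
  imports Defs
begin

text \<open>Suppose a policy achieves \<open>\<gamma>\<close> on a schedule whose longest interval is \<open>h\<close>, and let \<open>g > \<gamma>\<close>.
  Undisturbed, the system rests at \<open>0\<close> with \<open>u = 0\<close>; so during an interval of length \<open>h\<close> that
  starts at rest the controller, blind to the disturbance, keeps \<open>u = 0\<close>. Afterwards the
  disturbance can secure the value of any finite-horizon full-information game at level \<open>g\<close>.
  Hence the Riccati iterates from \<open>0\<close> stay below \<open>\<gamma>\<^sup>2\<close>, they increase to a fixed point \<open>\<beta>\<close>, and the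
  uncontrolled \<open>h\<close>-step response \<open>e\<close> to any \<open>d\<close> satisfies
  \<open>\<Sum> (|C e|\<^sup>2 - \<gamma>\<^sup>2 |d|\<^sup>2) + \<beta> (e\<^sub>h, e\<^sub>h) \<le> 0\<close>.

  Conversely, completing the square at the saddle point of \<open>\<beta>\<close> shows that applying its control
  to the state predicted from the last sample costs at most \<open>\<beta> (x, x)\<close> over an interval, provided
  that this inequality holds for the length of the interval; and it passes from \<open>h\<close> to shorter
  lengths by delaying \<open>d\<close>. So the longest interval alone decides which levels are achievable.\<close>

lemma sum_lessThan_add:
  fixes f :: "nat \<Rightarrow> 'a::comm_monoid_add"
  shows "(\<Sum>k<m + n. f k) = (\<Sum>k<m. f k) + (\<Sum>k<n. f (m + k))"
  by (induction n) (auto simp: add.assoc)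

section \<open>Quadratic forms\<close>

text \<open>Plays the part of a positive semidefinite cost matrix, without coordinates.\<close>

definition psd_form :: "('a::real_vector \<Rightarrow> 'a \<Rightarrow> real) \<Rightarrow> bool" where
  "psd_form \<beta> \<longleftrightarrow> bilinear \<beta> \<and> (\<forall>x y. \<beta> x y = \<beta> y x) \<and> (\<forall>x. 0 \<le> \<beta> x x)"

lemma psd_formD:
  assumes "psd_form \<beta>"
  shows "bilinear \<beta>" "\<beta> x y = \<beta> y x" "0 \<le> \<beta> x x"
  using assms unfolding psd_form_def by blast+

lemma psd_form_zero: "psd_form (\<lambda>_ _. 0)"
  by (simp add: psd_form_def bilinear_def linear_iff)

lemma linear_functional_eq_inner:
  fixes f :: "'v::euclidean_space \<Rightarrow> real"
  assumes "linear f"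
  shows "f v = (\<Sum>i\<in>Basis. f i *\<^sub>R i) \<bullet> v"
proof -
  have "f v = f (\<Sum>i\<in>Basis. (v \<bullet> i) *\<^sub>R i)"
    by (simp add: euclidean_representation)
  also have "\<dots> = (\<Sum>i\<in>Basis. (v \<bullet> i) * f i)"
    by (simp add: linear_sum[OF assms] linear_cmul[OF assms])
  finally show ?thesis
    by (simp add: inner_sum_left inner_commute[of v] mult.commute)
qed

text \<open>In finite dimension the map \<open>G\<close> representing \<open>\<theta>\<close> is
  injective, hence invertible, and \<open>M\<close> is its inverse after the map \<open>H\<close>
  representing \<open>c\<close>. This will give a stationary point linear in the state.\<close>

lemma nondegenerate_form_represents:
  fixes \<theta> :: "'v::euclidean_space \<Rightarrow> 'v \<Rightarrow> real" and c :: "'x::real_vector \<Rightarrow> 'v \<Rightarrow> real"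
  assumes \<theta>: "bilinear \<theta>" and c: "bilinear c"
    and nondegenerate: "\<And>v. (\<And>v'. \<theta> v v' = 0) \<Longrightarrow> v = 0"
  obtains M where "linear M" "\<And>x v. \<theta> (M x) v = c x v"
proof -
  define G where "G v = (\<Sum>i\<in>Basis. \<theta> v i *\<^sub>R i)" for v
  define H where "H x = (\<Sum>i\<in>Basis. c x i *\<^sub>R i)" for x
  have G: "\<theta> v w = G v \<bullet> w" for v w
    unfolding G_def using \<theta> linear_functional_eq_inner[of "\<theta> v" w] by (simp add: bilinear_def)
  have H: "c x w = H x \<bullet> w" for x w
    unfolding H_def using c linear_functional_eq_inner[of "c x" w] by (simp add: bilinear_def)
  have "linear G"
    unfolding linear_iff G_def
    by (simp add: bilinear_ladd[OF \<theta>] bilinear_lmul[OF \<theta>] scaleR_left_distrib sum.distrib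
        scaleR_sum_right)
  moreover have "inj G"
    unfolding linear_injective_0[OF \<open>linear G\<close>] using nondegenerate by (simp add: G)
  ultimately obtain G' where G': "linear G'" "\<And>v. G (G' v) = v"
    using linear_injective_isomorphism by blast
  have "linear H"
    unfolding linear_iff H_def
    by (simp add: bilinear_ladd[OF c] bilinear_lmul[OF c] scaleR_left_distrib sum.distrib
        scaleR_sum_right)
  then have "linear (G' \<circ> H)"
    using G' linear_compose by blast
  moreover have "\<theta> ((G' \<circ> H) x) v = c x v" for x v
    by (simp add: G H G')
  ultimately show ?thesis
    using that by blast
qed

text \<open>Monotone bounded convergence on the diagonal extends to all arguments by
  polarization.\<close>

lemma psd_form_limit:
  fixes \<beta> :: "nat \<Rightarrow> 'a::real_inner \<Rightarrow> 'a \<Rightarrow> real"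
  assumes psd: "\<And>m. psd_form (\<beta> m)"
    and mono: "\<And>m x. \<beta> m x x \<le> \<beta> (Suc m) x x"
    and bound: "\<And>m x. \<beta> m x x \<le> c * (x \<bullet> x)"
  obtains \<beta>' where "psd_form \<beta>'" "\<And>x y. (\<lambda>m. \<beta> m x y) \<longlonglongrightarrow> \<beta>' x y"
proof -
  have diagonal: "convergent (\<lambda>m. \<beta> m x x)" for x
    using incseq_convergent[of "\<lambda>m. \<beta> m x x" "c * (x \<bullet> x)"] mono bound
    unfolding convergent_def incseq_Suc_iff by metis
  have polarization: "\<beta> m x y = (\<beta> m (x + y) (x + y) - \<beta> m x x - \<beta> m y y) / 2" for m x y
    using psd_formD(2)[OF psd, of m x y]
    by (simp add: bilinear_ladd[OF psd_formD(1)[OF psd]] bilinear_radd[OF psd_formD(1)[OF psd]])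
  define \<beta>' where "\<beta>' x y = lim (\<lambda>m. \<beta> m x y)" for x y
  have "convergent (\<lambda>m. \<beta> m x y)" for x y
    unfolding polarization[of _ x y] divide_inverse
    by (intro convergent_mult convergent_diff diagonal convergent_const)
  then have lim: "(\<lambda>m. \<beta> m x y) \<longlonglongrightarrow> \<beta>' x y" for x y
    by (simp add: \<beta>'_def convergent_LIMSEQ_iff)
  note unique = LIMSEQ_unique[OF lim]
  have "psd_form \<beta>'"
    unfolding psd_form_def bilinear_def linear_iff
  proof (intro conjI allI)
    fix x y z r
    note bil = psd_formD(1)[OF psd]
    show "\<beta>' x (y + z) = \<beta>' x y + \<beta>' x z"
      using tendsto_add[OF lim lim] by (intro unique) (simp add: bilinear_radd[OF bil])
    show "\<beta>' (x + z) y = \<beta>' x y + \<beta>' z y"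
      using tendsto_add[OF lim lim] by (intro unique) (simp add: bilinear_ladd[OF bil])
    show "\<beta>' x (r *\<^sub>R y) = r *\<^sub>R \<beta>' x y"
      using tendsto_scaleR[OF tendsto_const lim] by (intro unique) (simp add: bilinear_rmul[OF bil])
    show "\<beta>' (r *\<^sub>R x) y = r *\<^sub>R \<beta>' x y"
      using tendsto_scaleR[OF tendsto_const lim] by (intro unique) (simp add: bilinear_lmul[OF bil])
    show "\<beta>' x y = \<beta>' y x"
      using lim[of y x] by (intro unique) (simp add: psd_formD(2)[OF psd, of _ x y])
    show "0 \<le> \<beta>' x x"
      using lim psd_formD(3)[OF psd] by (intro LIMSEQ_le_const[OF lim]) auto
  qed
  with lim show ?thesis
    using that by blast
qed

section \<open>The Riccati recursion\<close>

locale linear_game =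
  fixes A :: "'x::euclidean_space \<Rightarrow> 'x" and B :: "'u::euclidean_space \<Rightarrow> 'x"
    and C :: "'x \<Rightarrow> 'p::euclidean_space" and D :: "'u \<Rightarrow> 'p"
  assumes linear_A: "linear A" and linear_B: "linear B"
    and linear_C: "linear C" and linear_D: "linear D"
    and inj_D: "inj D"
begin

definition stage :: "real \<Rightarrow> 'x \<Rightarrow> 'u \<Rightarrow> 'x \<Rightarrow> real" where
  "stage g x u w = C x \<bullet> C x + D u \<bullet> D u - g\<^sup>2 * (w \<bullet> w)"

text \<open>Second-order part of the one-step cost about its saddle point. For positive semidefinite
  \<open>\<beta>\<close> it is nonnegative in \<open>a\<close> at \<open>b = 0\<close>; it is
  nonpositive in \<open>b\<close> at \<open>a = 0\<close> when \<open>g\<close> dominates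
  \<open>\<beta>\<close>.\<close>

definition deviation :: "real \<Rightarrow> ('x \<Rightarrow> 'x \<Rightarrow> real) \<Rightarrow> 'u \<Rightarrow> 'x \<Rightarrow> real" where
  "deviation g \<beta> a b = D a \<bullet> D a - g\<^sup>2 * (b \<bullet> b) + \<beta> (B a + b) (B a + b)"

text \<open>The one-step game with terminal cost \<open>\<beta>\<close> has the saddle point \<open>u = K x\<close>, \<open>w = L x\<close> of
  value \<open>\<beta>' x x\<close>, expressed by completing the square at this point.\<close>

definition riccati_step ::
  "real \<Rightarrow> ('x \<Rightarrow> 'x \<Rightarrow> real) \<Rightarrow> ('x \<Rightarrow> 'x \<Rightarrow> real) \<Rightarrow> ('x \<Rightarrow> 'u) \<Rightarrow> ('x \<Rightarrow> 'x) \<Rightarrow> bool"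
where
  "riccati_step g \<beta> \<beta>' K L \<longleftrightarrow> linear K \<and> linear L \<and>
     (\<forall>x u w. stage g x u w + \<beta> (A x + B u + w) (A x + B u + w)
            = \<beta>' x x + deviation g \<beta> (u - K x) (w - L x))"

lemma riccati_stepD:
  assumes "riccati_step g \<beta> \<beta>' K L"
  shows "linear K" "linear L"
    "stage g x u w + \<beta> (A x + B u + w) (A x + B u + w)
     = \<beta>' x x + deviation g \<beta> (u - K x) (w - L x)"
  using assms by (auto simp: riccati_step_def)

lemma stage_antimono: "\<gamma>\<^sup>2 \<le> g\<^sup>2 \<Longrightarrow> stage g x u w \<le> stage \<gamma> x u w"
  by (simp add: stage_def mult_right_mono)

lemma D_eq_0_iff: "D u = 0 \<longleftrightarrow> u = 0"
  using linear_injective_0[OF linear_D, THEN iffD1, OF inj_D] linear_0[OF linear_D] by blast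

lemma deviation_control_nonneg: "psd_form \<beta> \<Longrightarrow> 0 \<le> deviation g \<beta> a 0"
  by (simp add: deviation_def psd_formD)

lemma deviation_disturbance_nonpos:
  "\<beta> b b \<le> g\<^sup>2 * (b \<bullet> b) \<Longrightarrow> deviation g \<beta> 0 b \<le> 0"
  by (simp add: deviation_def linear_0[OF linear_D] linear_0[OF linear_B])

lemma riccati_step_exists:
  assumes psd: "psd_form \<beta>" and concave: "\<And>b. b \<noteq> 0 \<Longrightarrow> \<beta> b b < g\<^sup>2 * (b \<bullet> b)"
  obtains \<beta>' K L where "psd_form \<beta>'" "riccati_step g \<beta> \<beta>' K L"
proof -
  note bil = psd_formD(1)[OF psd]
  note expand = bilinear_ladd[OF bil] bilinear_radd[OF bil] bilinear_lmul[OF bil]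
    bilinear_rmul[OF bil] bilinear_lsub[OF bil] bilinear_rsub[OF bil]
    linear_add[OF linear_A] linear_add[OF linear_B] linear_add[OF linear_C] linear_add[OF linear_D]
    linear_cmul[OF linear_A] linear_cmul[OF linear_B] linear_cmul[OF linear_C]
    linear_cmul[OF linear_D] inner_add_left inner_add_right
  \<comment> \<open>\<open>\<theta>\<close> polarizes \<open>deviation\<close>, and \<open>c\<close>
    is minus half the part of the cost linear in \<open>(u, w)\<close>; so
    \<open>\<theta> (M x) = c x\<close> is the first-order condition.\<close>
  define \<theta> where "\<theta> v v' = D (fst v) \<bullet> D (fst v') - g\<^sup>2 * (snd v \<bullet> snd v')
      + \<beta> (B (fst v) + snd v) (B (fst v') + snd v')" for v v' :: "'u \<times> 'x"
  define c where "c x v = - \<beta> (A x) (B (fst v) + snd v)" for x and v :: "'u \<times> 'x"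
  have \<theta>: "bilinear \<theta>"
    by (simp add: bilinear_def linear_iff \<theta>_def expand algebra_simps)
  have c: "bilinear c"
    by (simp add: bilinear_def linear_iff c_def expand algebra_simps)
  have nondegenerate: "v = 0" if zero: "\<And>v'. \<theta> v v' = 0" for v
  proof -
    obtain a b where v: "v = (a, b)"
      by (cases v)
    \<comment> \<open>Flipping the sign of the disturbance cancels the cross terms and leaves a sum
      of nonnegative ones.\<close>
    have "0 = \<theta> v (a, - b)"
      using zero by simp
    also have "\<dots> = D a \<bullet> D a + \<beta> (B a) (B a) + (g\<^sup>2 * (b \<bullet> b) - \<beta> b b)"
      using psd_formD(2)[OF psd, of "B a" b] by (simp add: \<theta>_def v expand)
    finally have eq: "D a \<bullet> D a + \<beta> (B a) (B a) + (g\<^sup>2 * (b \<bullet> b) - \<beta> b b) = 0"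
      by simp
    have "0 \<le> \<beta> (B a) (B a)"
      by (simp add: psd_formD(3)[OF psd])
    have b: "b = 0"
      using concave[of b] eq \<open>0 \<le> \<beta> (B a) (B a)\<close> inner_ge_zero[of "D a"]
      by (cases "b = 0") (assumption, linarith)
    then have "D a \<bullet> D a \<le> 0"
      using eq \<open>0 \<le> \<beta> (B a) (B a)\<close> by (simp add: bilinear_lzero[OF bil])
    then have "D a = 0"
      by (metis inner_eq_zero_iff inner_ge_zero antisym)
    with b show ?thesis
      by (simp add: v D_eq_0_iff zero_prod_def)
  qed
  obtain M where M: "linear M" "\<And>x v. \<theta> (M x) v = c x v"
    using nondegenerate_form_represents[OF \<theta> c nondegenerate] by blast
  define K where "K x = fst (M x)" for x
  define L where "L x = snd (M x)" for x
  have K: "linear K" and L: "linear L"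
    using M(1) by (auto simp: K_def L_def linear_iff)
  define F where "F x = A x + B (K x) + L x" for x
  define \<beta>' where "\<beta>' x y = C x \<bullet> C y + D (K x) \<bullet> D (K y) - g\<^sup>2 * (L x \<bullet> L y) + \<beta> (F x) (F y)" for x y
  have F: "linear F"
    unfolding F_def linear_iff
    by (simp add: expand linear_add[OF K] linear_add[OF L]
        linear_cmul[OF K] linear_cmul[OF L] scaleR_add_right)
  have stationary: "D (K x) \<bullet> D a - g\<^sup>2 * (L x \<bullet> b) + \<beta> (F x) (B a + b) = 0" for x a b
    using M(2)[of x "(a, b)"] by (simp add: \<theta>_def c_def K_def L_def F_def expand)
  have step: "riccati_step g \<beta> \<beta>' K L"
    unfolding riccati_step_def
  proof (intro conjI allI K L)
    fix x u w
    define a where "a = u - K x"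
    define b where "b = w - L x"
    have u: "u = K x + a" and w: "w = L x + b"
      by (simp_all add: a_def b_def)
    have next_eq: "A x + B u + w = F x + (B a + b)"
      by (simp add: u w F_def expand)
    have sym: "\<beta> (B a + b) (F x) = \<beta> (F x) (B a + b)"
      by (rule psd_formD(2)[OF psd])
    have "\<beta> (A x + B u + w) (A x + B u + w)
        = \<beta> (F x) (F x) + 2 * \<beta> (F x) (B a + b) + \<beta> (B a + b) (B a + b)"
      unfolding next_eq bilinear_ladd[OF bil, of "F x" "B a + b"]
        bilinear_radd[OF bil, of _ "F x" "B a + b"] sym by simp
    moreover have "D u \<bullet> D u = D (K x) \<bullet> D (K x) + 2 * (D (K x) \<bullet> D a) + D a \<bullet> D a"
      by (simp add: u expand inner_commute)
    moreover have "g\<^sup>2 * (w \<bullet> w) = g\<^sup>2 * (L x \<bullet> L x) + 2 * (g\<^sup>2 * (L x \<bullet> b)) + g\<^sup>2 * (b \<bullet> b)"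
      by (simp add: w inner_commute algebra_simps)
    ultimately show "stage g x u w + \<beta> (A x + B u + w) (A x + B u + w)
        = \<beta>' x x + deviation g \<beta> (u - K x) (w - L x)"
      using stationary[of x a b]
      unfolding a_def[symmetric] b_def[symmetric] stage_def deviation_def \<beta>'_def by linarith
  qed
  have "psd_form \<beta>'"
    unfolding psd_form_def
  proof (intro conjI allI)
    show "bilinear \<beta>'"
      by (simp add: bilinear_def linear_iff \<beta>'_def expand linear_add[OF K] linear_add[OF L]
          linear_add[OF F] linear_cmul[OF F] linear_cmul[OF K] linear_cmul[OF L] algebra_simps)
    fix x y
    show "\<beta>' x y = \<beta>' y x"
      using psd_formD(2)[OF psd] by (simp add: \<beta>'_def inner_commute)
    \<comment> \<open>Against \<open>K x\<close>, replacing the disturbance \<open>L x\<close> by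
      \<open>0\<close> cannot raise the cost, which is then nonnegative.\<close>
    have "deviation g \<beta> (K x - K x) (0 - L x) \<le> 0"
      unfolding diff_self
      using concave[of "0 - L x"] bilinear_lzero[OF bil]
      by (intro deviation_disturbance_nonpos) (cases "L x = 0"; simp)
    then show "0 \<le> \<beta>' x x"
      using riccati_stepD(3)[OF step, of x "K x" 0] psd_formD(3)[OF psd, of "A x + B (K x) + 0"]
        inner_ge_zero[of "C x"] inner_ge_zero[of "D (K x)"]
      unfolding stage_def inner_zero_left mult_zero_right by linarith
  qed
  with step show ?thesis
    using that by blast
qed

section \<open>Monotone value iteration and its limit\<close>

lemma riccati_step_mono:
  assumes step: "riccati_step g \<beta> \<beta>' K L" and step2: "riccati_step g \<beta>2 \<beta>2' K2 L2"
    and psd: "psd_form \<beta>" and le: "\<And>x. \<beta> x x \<le> \<beta>2 x x"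
    and bound: "\<And>b. \<beta>2 b b \<le> g\<^sup>2 * (b \<bullet> b)"
  shows "\<beta>' x x \<le> \<beta>2' x x"
proof -
  \<comment> \<open>Mixed play: \<open>L\<close> is worst for \<open>\<beta>\<close> and
    \<open>K2\<close> best for \<open>\<beta>2\<close>, so the pair costs at least
    \<open>\<beta>' x x\<close> with \<open>\<beta>\<close> and at most \<open>\<beta>2' x x\<close>
    with \<open>\<beta>2\<close>.\<close>
  define y where "y = A x + B (K2 x) + L x"
  have "\<beta>' x x \<le> stage g x (K2 x) (L x) + \<beta> y y"
    using riccati_stepD(3)[OF step, of x "K2 x" "L x"] deviation_control_nonneg[OF psd]
    unfolding y_def by simp
  also have "\<dots> \<le> stage g x (K2 x) (L x) + \<beta>2 y y"
    using le by simp
  also have "\<dots> \<le> \<beta>2' x x"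
    using riccati_stepD(3)[OF step2, of x "K2 x" "L x"]
      deviation_disturbance_nonpos[of \<beta>2 "L x - L2 x" g, OF bound]
    unfolding y_def by simp
  finally show ?thesis .
qed

text \<open>Let \<open>\<delta>\<close> be the step from the limit \<open>\<beta>'\<close>.
  Monotonicity gives \<open>\<beta>' \<le> \<delta>\<close> on the diagonal. Conversely, the
  controls of the iterates stay bounded, and a limit point of them keeps the cost within
  \<open>\<beta>'\<close>.\<close>

lemma riccati_step_limit:
  assumes psd: "\<And>m. psd_form (\<beta> m)"
    and step: "\<And>m. \<exists>K L. riccati_step g (\<beta> m) (\<beta> (Suc m)) K L"
    and initial: "\<beta> 0 = (\<lambda>_ _. 0)"
    and bound: "\<And>m b. \<beta> m b b \<le> \<gamma>\<^sup>2 * (b \<bullet> b)"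
    and \<gamma>: "0 < \<gamma>" "\<gamma> < g"
  obtains \<beta>' K L where "psd_form \<beta>'" "riccati_step g \<beta>' \<beta>' K L"
    "\<And>x y. (\<lambda>m. \<beta> m x y) \<longlonglongrightarrow> \<beta>' x y"
proof -
  have \<gamma>_less: "\<gamma>\<^sup>2 < g\<^sup>2"
    using \<gamma> by (simp add: power_strict_mono)
  have bound_g: "\<beta> m b b \<le> g\<^sup>2 * (b \<bullet> b)" for m b
    using bound[of m b] mult_right_mono[OF less_imp_le[OF \<gamma>_less], of "b \<bullet> b"] by simp
  have mono: "\<beta> m x x \<le> \<beta> (Suc m) x x" for m x
  proof (induction m arbitrary: x)
    case 0
    then show ?case
      by (simp add: initial psd_formD(3)[OF psd])
  next
    case (Suc m)
    obtain K L K2 L2 where "riccati_step g (\<beta> m) (\<beta> (Suc m)) K L"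
      "riccati_step g (\<beta> (Suc m)) (\<beta> (Suc (Suc m))) K2 L2"
      using step by meson
    then show ?case
      using riccati_step_mono[where \<beta>="\<beta> m" and ?\<beta>2.0="\<beta> (Suc m)"] psd Suc bound_g by blast
  qed
  obtain \<beta>' where \<beta>': "psd_form \<beta>'" and lim: "\<And>x y. (\<lambda>m. \<beta> m x y) \<longlonglongrightarrow> \<beta>' x y"
    using psd_form_limit[of \<beta>, OF psd mono bound] by blast
  have incseq: "incseq (\<lambda>m. \<beta> m x x)" for x
    using mono by (simp add: incseq_Suc_iff)
  have below: "\<beta> m x x \<le> \<beta>' x x" for m x
    using incseq_le[OF incseq lim] .
  have bound': "\<beta>' b b \<le> \<gamma>\<^sup>2 * (b \<bullet> b)" for b
    using bound by (intro LIMSEQ_le_const2[OF lim]) auto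
  have concave: "\<beta>' b b < g\<^sup>2 * (b \<bullet> b)" if "b \<noteq> 0" for b
    using bound'[of b] mult_strict_right_mono[OF \<gamma>_less, of "b \<bullet> b"] that
    by (simp add: order_le_less_trans)
  then have bound_g': "\<beta>' b b \<le> g\<^sup>2 * (b \<bullet> b)" for b
    by (cases "b = 0") (auto simp: less_imp_le bilinear_lzero[OF psd_formD(1)[OF \<beta>']])
  obtain \<delta> K L where \<delta>: "riccati_step g \<beta>' \<delta> K L"
    using riccati_step_exists[OF \<beta>' concave] by blast
  have "\<delta> x x = \<beta>' x x" for x
  proof (rule antisym)
    have "\<beta> (Suc m) x x \<le> \<delta> x x" for m
      using step[of m] riccati_step_mono[where \<beta>="\<beta> m", OF _ \<delta>] psd below bound_g' by blast
    then show "\<beta>' x x \<le> \<delta> x x"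
      by (intro LIMSEQ_le_const2[OF LIMSEQ_Suc[OF lim]]) auto
  next
    obtain KK LL where KL: "\<And>m. riccati_step g (\<beta> m) (\<beta> (Suc m)) (KK m) (LL m)"
      using step by metis
    have upper: "stage g x (KK m x) w + \<beta> m (A x + B (KK m x) + w) (A x + B (KK m x) + w) \<le> \<beta>' x x"
      for m w
      using riccati_stepD(3)[OF KL[of m], of x "KK m x" w]
        deviation_disturbance_nonpos[of "\<beta> m" "w - LL m x" g, OF bound_g] below[of "Suc m" x]
      by simp
    obtain r where r: "r > 0" "\<And>u. r * norm u \<le> norm (D u)"
      using linear_inj_bounded_below_pos[OF linear_D inj_D] by blast
    have "norm (KK m x) \<le> sqrt (\<beta>' x x) / r" for m
    proof -
      have "D (KK m x) \<bullet> D (KK m x) \<le> \<beta>' x x"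
        using upper[of m 0] psd_formD(3)[OF psd, of m "A x + B (KK m x) + 0"] inner_ge_zero[of "C x"]
        unfolding stage_def inner_zero_left mult_zero_right by linarith
      then have "norm (D (KK m x)) \<le> sqrt (\<beta>' x x)"
        by (simp add: norm_eq_sqrt_inner)
      then show ?thesis
        using r(2)[of "KK m x"] r(1) by (simp add: field_simps)
    qed
    then have "bounded (range (\<lambda>m. KK m x))"
      by (auto simp: bounded_iff)
    then obtain k \<rho> where \<rho>: "strict_mono \<rho>" "(\<lambda>n. KK (\<rho> n) x) \<longlonglongrightarrow> k"
      using bounded_imp_convergent_subsequence[of "\<lambda>m. KK m x"] unfolding comp_def by blast
    define cost where "cost \<beta> u = stage g x u (L x) + \<beta> (A x + B u + L x) (A x + B u + L x)"
      for \<beta> :: "'x \<Rightarrow> 'x \<Rightarrow> real" and u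
    \<comment> \<open>\<open>M\<close> stays fixed while the controls tend to \<open>k\<close>,
      since \<open>cost (\<beta> M)\<close> is continuous in the control; \<open>M\<close> grows
      only afterwards.\<close>
    have "cost (\<beta> M) k \<le> \<beta>' x x" for M
    proof (rule LIMSEQ_le_const2)
      have "bounded_bilinear (\<beta> M)"
        using psd_formD(1)[OF psd] by (simp add: bilinear_conv_bounded_bilinear)
      note tendsto = bounded_bilinear.tendsto[OF this]
        bounded_linear.tendsto[OF linear_conv_bounded_linear[THEN iffD1, OF linear_B]]
        bounded_linear.tendsto[OF linear_conv_bounded_linear[THEN iffD1, OF linear_D]]
      show "(\<lambda>n. cost (\<beta> M) (KK (\<rho> n) x)) \<longlonglongrightarrow> cost (\<beta> M) k"
        unfolding cost_def stage_def
        by (intro tendsto_intros tendsto \<rho>(2))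
      have "cost (\<beta> M) (KK (\<rho> n) x) \<le> \<beta>' x x" if "M \<le> n" for n
      proof -
        have "M \<le> \<rho> n"
          using that seq_suble[OF \<rho>(1), of n] by simp
        then have "cost (\<beta> M) (KK (\<rho> n) x) \<le> cost (\<beta> (\<rho> n)) (KK (\<rho> n) x)"
          unfolding cost_def using incseqD[OF incseq] by simp
        also have "\<dots> \<le> \<beta>' x x"
          unfolding cost_def by (rule upper)
        finally show ?thesis .
      qed
      then show "\<exists>N. \<forall>n\<ge>N. cost (\<beta> M) (KK (\<rho> n) x) \<le> \<beta>' x x"
        by blast
    qed
    then have "cost \<beta>' k \<le> \<beta>' x x"
      using lim unfolding cost_def
      by (intro LIMSEQ_le_const2[OF tendsto_add[OF tendsto_const lim]]) auto
    \<comment> \<open>Against \<open>L x\<close> only the control deviates from the saddle point, so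
      the cost of \<open>k\<close> is at least \<open>\<delta> x x\<close>.\<close>
    then show "\<delta> x x \<le> \<beta>' x x"
      using riccati_stepD(3)[OF \<delta>, of x k "L x"] deviation_control_nonneg[OF \<beta>', of g "k - K x"]
      unfolding cost_def by simp
  qed
  then have "riccati_step g \<beta>' \<beta>' K L"
    using \<delta> by (simp add: riccati_step_def)
  with \<beta>' lim show ?thesis
    using that by blast
qed

text \<open>A relation rather than a function: a further step is known to exist only where
  \<open>g\<close> strictly dominates the form, which the existence of a policy will ensure.\<close>

inductive riccati_iterate :: "real \<Rightarrow> nat \<Rightarrow> ('x \<Rightarrow> 'x \<Rightarrow> real) \<Rightarrow> bool" for g where
  zero: "riccati_iterate g 0 (\<lambda>_ _. 0)"
| Suc: "riccati_iterate g m \<beta> \<Longrightarrow> psd_form \<beta>' \<Longrightarrow> riccati_step g \<beta> \<beta>' K L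
    \<Longrightarrow> riccati_iterate g (Suc m) \<beta>'"

lemma riccati_iterate_psd: "riccati_iterate g m \<beta> \<Longrightarrow> psd_form \<beta>"
  by (induction rule: riccati_iterate.induct) (auto simp: psd_form_zero)

section \<open>The uncontrolled response to a disturbance\<close>

primrec free_response :: "(nat \<Rightarrow> 'x) \<Rightarrow> nat \<Rightarrow> 'x" where
  "free_response d 0 = 0"
| "free_response d (Suc k) = A (free_response d k) + d k"

lemma free_response_cong:
  "(\<And>i. i < k \<Longrightarrow> d i = d' i) \<Longrightarrow> free_response d k = free_response d' k"
  by (induction k) auto

lemma free_response_delayed:
  "free_response (\<lambda>i. if i < j then 0 else d (i - j)) (j + k) = free_response d k"
proof -
  let ?d = "\<lambda>i. if i < j then 0 else d (i - j)"
  have "free_response ?d i = 0" if "i \<le> j" for i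
    using that by (induction i) (auto simp: linear_0[OF linear_A])
  then show ?thesis
    by (induction k) auto
qed

text \<open>A disturbance that acts for \<open>h\<close> steps on the uncontrolled system at rest
  and then collects the value \<open>\<beta>\<close> gains nothing.\<close>

definition open_loop_bound :: "real \<Rightarrow> ('x \<Rightarrow> 'x \<Rightarrow> real) \<Rightarrow> nat \<Rightarrow> bool" where
  "open_loop_bound g \<beta> h \<longleftrightarrow>
     (\<forall>d. (\<Sum>k<h. stage g (free_response d k) 0 (d k))
          + \<beta> (free_response d h) (free_response d h) \<le> 0)"

lemma open_loop_bound_mono_level:
  assumes "open_loop_bound \<gamma> \<beta> h" and "\<gamma>\<^sup>2 \<le> g\<^sup>2"
  shows "open_loop_bound g \<beta> h"
  unfolding open_loop_bound_def
proof
  fix d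
  have "(\<Sum>k<h. stage g (free_response d k) 0 (d k))
      \<le> (\<Sum>k<h. stage \<gamma> (free_response d k) 0 (d k))"
    by (intro sum_mono stage_antimono assms)
  then show "(\<Sum>k<h. stage g (free_response d k) 0 (d k))
      + \<beta> (free_response d h) (free_response d h) \<le> 0"
    using assms(1)[unfolded open_loop_bound_def, rule_format, of d] by linarith
qed

text \<open>Waiting \<open>h - h'\<close> steps before playing \<open>d\<close> leaves the system at
  rest at no cost.\<close>

lemma open_loop_bound_antimono:
  assumes h: "open_loop_bound g \<beta> h" and le: "h' \<le> h"
  shows "open_loop_bound g \<beta> h'"
  unfolding open_loop_bound_def
proof
  fix d :: "nat \<Rightarrow> 'x"
  define j where "j = h - h'"
  define d' where "d' = (\<lambda>i. if i < j then 0 else d (i - j))"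
  have hj: "h = j + h'"
    using le by (simp add: j_def)
  have delayed: "free_response d' (j + k) = free_response d k" for k
    unfolding d'_def by (rule free_response_delayed)
  have late: "d' (j + k) = d k" for k
    by (simp add: d'_def)
  have early: "free_response d' k = 0" if "k \<le> j" for k
    using that by (induction k) (auto simp: d'_def linear_0[OF linear_A])
  have "(\<Sum>k<h. stage g (free_response d' k) 0 (d' k))
      = (\<Sum>k<j. stage g (free_response d' k) 0 (d' k))
        + (\<Sum>k<h'. stage g (free_response d' (j + k)) 0 (d' (j + k)))"
    unfolding hj by (rule sum_lessThan_add)
  also have "(\<Sum>k<j. stage g (free_response d' k) 0 (d' k)) = 0"
    by (intro sum.neutral ballI)
      (simp add: early stage_def linear_0[OF linear_C] linear_0[OF linear_D], simp add: d'_def)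
  finally have "(\<Sum>k<h. stage g (free_response d' k) 0 (d' k))
      = (\<Sum>k<h'. stage g (free_response d k) 0 (d k))"
    by (simp add: delayed late)
  then show "(\<Sum>k<h'. stage g (free_response d k) 0 (d k))
      + \<beta> (free_response d h') (free_response d h') \<le> 0"
    using h[unfolded open_loop_bound_def, rule_format, of d'] delayed[of h']
    unfolding hj[symmetric] by simp
qed

text \<open>One uncontrolled step from rest leads to \<open>b\<close> itself. At level
  \<open>\<gamma>\<close> this yields the strict domination that a Riccati step needs at a level
  above \<open>\<gamma>\<close>.\<close>

lemma open_loop_bound_one:
  assumes "open_loop_bound g \<beta> h" and "0 < h"
  shows "\<beta> b b \<le> g\<^sup>2 * (b \<bullet> b)"
proof -
  have "open_loop_bound g \<beta> 1"
    using assms open_loop_bound_antimono[of g \<beta> h 1] by simp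
  then have "stage g 0 0 b + \<beta> b b \<le> 0"
    by (auto simp: open_loop_bound_def linear_0[OF linear_A] dest: spec[of _ "\<lambda>_. b"])
  then show ?thesis
    by (simp add: stage_def linear_0[OF linear_C] linear_0[OF linear_D])
qed

text \<open>The bound at level \<open>\<gamma>\<close> keeps the recursion at level \<open>g\<close>
  from breaking off, and it survives the limit.\<close>

lemma riccati_fixed_point_exists:
  assumes bound: "\<And>m \<beta>. riccati_iterate g m \<beta> \<Longrightarrow> open_loop_bound \<gamma> \<beta> h"
    and "0 < h" "0 < \<gamma>" "\<gamma> < g"
  obtains \<beta> K L where "psd_form \<beta>" "riccati_step g \<beta> \<beta> K L" "open_loop_bound \<gamma> \<beta> h"
proof -
  have \<gamma>_less: "\<gamma>\<^sup>2 < g\<^sup>2"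
    using assms by (simp add: power_strict_mono)
  note iterate_bound = open_loop_bound_one[OF bound \<open>0 < h\<close>]
  \<comment> \<open>The clause for \<open>m = 0\<close> records that the sequence starts at the zero
    form.\<close>
  have "\<exists>\<beta>. \<forall>m. (riccati_iterate g m (\<beta> m) \<and> (m = 0 \<longrightarrow> \<beta> m = (\<lambda>_ _. 0)))
      \<and> (\<exists>K L. riccati_step g (\<beta> m) (\<beta> (Suc m)) K L)"
  proof (rule dependent_nat_choice)
    show "\<exists>\<beta>. riccati_iterate g 0 \<beta> \<and> (0 = 0 \<longrightarrow> \<beta> = (\<lambda>_ _. 0))"
      using riccati_iterate.zero by blast
  next
    fix \<beta> m
    assume "riccati_iterate g m \<beta> \<and> (m = 0 \<longrightarrow> \<beta> = (\<lambda>_ _. 0))"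
    then have it: "riccati_iterate g m \<beta>" ..
    have "\<beta> b b < g\<^sup>2 * (b \<bullet> b)" if "b \<noteq> 0" for b
      using iterate_bound[OF it, of b] mult_strict_right_mono[OF \<gamma>_less, of "b \<bullet> b"] that
      by (simp add: order_le_less_trans)
    then obtain \<beta>' K L where "psd_form \<beta>'" "riccati_step g \<beta> \<beta>' K L"
      using riccati_step_exists[OF riccati_iterate_psd[OF it]] by blast
    then show "\<exists>\<beta>'. (riccati_iterate g (Suc m) \<beta>' \<and> (Suc m = 0 \<longrightarrow> \<beta>' = (\<lambda>_ _. 0)))
        \<and> (\<exists>K L. riccati_step g \<beta> \<beta>' K L)"
      using riccati_iterate.Suc[OF it] by blast
  qed
  then obtain \<beta> where it: "\<And>m. riccati_iterate g m (\<beta> m)" and zero: "\<beta> 0 = (\<lambda>_ _. 0)"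
    and step: "\<And>m. \<exists>K L. riccati_step g (\<beta> m) (\<beta> (Suc m)) K L"
    by blast
  obtain \<beta>' K L where \<beta>': "psd_form \<beta>'" "riccati_step g \<beta>' \<beta>' K L"
    and lim: "\<And>x y. (\<lambda>m. \<beta> m x y) \<longlonglongrightarrow> \<beta>' x y"
    using riccati_step_limit[OF riccati_iterate_psd[OF it] step zero iterate_bound[OF it]
        \<open>0 < \<gamma>\<close> \<open>\<gamma> < g\<close>] by blast
  have "open_loop_bound \<gamma> \<beta>' h"
    unfolding open_loop_bound_def
    using bound[OF it] unfolding open_loop_bound_def
    by (intro allI LIMSEQ_le_const2[OF tendsto_add[OF tendsto_const lim]]) auto
  with \<beta>' show ?thesis
    using that by blast
qed

section \<open>Saddle point control applied to predicted states\<close>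

lemma riccati_telescope:
  assumes "riccati_step g \<beta> \<beta> K L"
    and "\<And>k. k < N \<Longrightarrow> x (Suc k) = A (x k) + B (u k) + w k"
  shows "(\<Sum>k<N. stage g (x k) (u k) (w k)) + \<beta> (x N) (x N)
    = \<beta> (x 0) (x 0) + (\<Sum>k<N. deviation g \<beta> (u k - K (x k)) (w k - L (x k)))"
  using assms(2)
proof (induction N)
  case (Suc N)
  then show ?case
    using riccati_stepD(3)[OF assms(1), of "x N" "u N" "w N"] by simp
qed simp

text \<open>Open-loop play of the saddle point control along the predicted trajectory \<open>F ^^ k\<close>: the
  prediction error is the uncontrolled response to the deviation of \<open>w\<close> from its predicted
  worst case, and it enters the cost exactly as this uncontrolled response started at \<open>0\<close>.\<close>

lemma open_loop_play:
  assumes step: "riccati_step g \<beta> \<beta> K L" and psd: "psd_form \<beta>"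
    and bound: "open_loop_bound g \<beta> N"
    and F: "F = (\<lambda>x. A x + B (K x) + L x)"
    and x: "\<And>k. k < N \<Longrightarrow> x (Suc k) = A (x k) + B (K ((F ^^ k) (x 0))) + w k"
  shows "(\<Sum>k<N. stage g (x k) (K ((F ^^ k) (x 0))) (w k)) + \<beta> (x N) (x N) \<le> \<beta> (x 0) (x 0)"
proof -
  define y where "y k = (F ^^ k) (x 0)" for k
  define d where "d k = w k - L (y k)" for k
  define e where "e = free_response d"
  \<comment> \<open>Both trajectories receive the control \<open>K (y k)\<close>, so it cancels in
    their difference.\<close>
  have e: "e k = x k - y k" if "k \<le> N" for k
    using that
  proof (induction k)
    case (Suc k)
    then show ?case
      by (simp add: e_def x y_def d_def F linear_diff[OF linear_A])
  qed (simp add: e_def y_def)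
  have "(\<Sum>k<N. deviation g \<beta> (K (y k) - K (x k)) (w k - L (x k)))
      = (\<Sum>k<N. deviation g \<beta> (0 - K (e k)) (d k - L (e k)))"
    by (intro sum.cong refl)
      (simp add: e d_def linear_diff[OF riccati_stepD(1)[OF step]]
        linear_diff[OF riccati_stepD(2)[OF step]])
  \<comment> \<open>Telescoping is used a second time, now along \<open>e\<close> with zero
    control.\<close>
  also have "\<dots> = (\<Sum>k<N. stage g (e k) 0 (d k)) + \<beta> (e N) (e N) - \<beta> (e 0) (e 0)"
    by (subst riccati_telescope[OF step]) (simp_all add: e_def linear_0[OF linear_B])
  also have "\<dots> \<le> 0"
    using bound bilinear_lzero[OF psd_formD(1)[OF psd]]
    by (simp add: open_loop_bound_def e_def)
  finally show ?thesis
    using riccati_telescope[OF step, of N x "\<lambda>k. K (y k)" w] x unfolding y_def by auto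
qed

end

section \<open>Sampling times\<close>

lemma sampling_time_simps [simp]:
  "sampling_time ts 0 = 0"
  "sampling_time ts (Suc l) = sampling_time ts l + interval ts l"
  by (simp_all add: sampling_time_def)

lemma interval_in_set: "schedule ts \<Longrightarrow> interval ts l \<in> set ts"
  by (simp add: schedule_def interval_def)

lemma interval_pos: "schedule ts \<Longrightarrow> 0 < interval ts l"
  using interval_in_set by (auto simp: schedule_def)

lemma interval_le_Max: "schedule ts \<Longrightarrow> interval ts l \<le> Max (set ts)"
  by (simp add: interval_in_set)

lemma interval_eq_Max:
  assumes "schedule ts"
  obtains l where "interval ts l = Max (set ts)"
proof -
  have "Max (set ts) \<in> set ts"
    using assms by (simp add: schedule_def)
  then obtain l where "l < length ts" "ts ! l = Max (set ts)"
    by (auto simp: in_set_conv_nth)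
  then show ?thesis
    using that[of l] by (simp add: interval_def)
qed

lemma mono_sampling_time: "mono (sampling_time ts)"
  by (simp add: mono_iff_le_Suc)

lemma le_sampling_time: "schedule ts \<Longrightarrow> l \<le> sampling_time ts l"
proof (induction l)
  case (Suc l)
  then show ?case
    using interval_pos[OF Suc.prems, of l] by simp
qed simp

lemma sampled_le_sampling_time:
  assumes "sampled ts r" "r \<le> sampling_time ts l + k" "k < interval ts l"
  shows "r \<le> sampling_time ts l"
proof -
  obtain l' where l': "r = sampling_time ts l'"
    using assms(1) by (auto simp: sampled_def)
  have "l' \<le> l"
  proof (rule ccontr)
    assume "\<not> l' \<le> l"
    then have "sampling_time ts (Suc l) \<le> r"
      unfolding l' by (intro monoD[OF mono_sampling_time]) simp
    with assms(2,3) show False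
      by simp
  qed
  then show ?thesis
    unfolding l' by (rule monoD[OF mono_sampling_time])
qed

lemma dom_information: "dom (information ts x t) = {r. r \<le> t \<and> sampled ts r}"
  by (auto simp: information_def split: if_splits)

section \<open>Policies and disturbances\<close>

locale sampled_system =
  fixes A :: "real^'n^'n" and B :: "real^'m^'n" and C :: "real^'n^'p" and D :: "real^'m^'p"
  assumes orthogonal: "transpose C ** D = 0"
    and positive: "positive_definite (transpose D ** D)"
begin

lemma inner_CD: "(C *v x) \<bullet> (D *v u) = 0"
proof -
  have "(C *v x) \<bullet> (D *v u) = x \<bullet> ((transpose C ** D) *v u)"
    by (metis dot_lmul_matrix inner_commute matrix_vector_mul_assoc transpose_matrix_vector)
  then show ?thesis
    by (simp add: orthogonal)
qed

lemma D_injective: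
  assumes "D *v u = 0"
  shows "u = 0"
proof (rule ccontr)
  assume "u \<noteq> 0"
  then have "0 < u \<bullet> ((transpose D ** D) *v u)"
    using positive unfolding positive_definite_def by blast
  then show False
    unfolding matrix_vector_mul_assoc[symmetric] assms by simp
qed

sublocale linear_game "(*v) A" "(*v) B" "(*v) C" "(*v) D"
proof (rule linear_game.intro)
  show "inj ((*v) D)"
    unfolding linear_injective_0[OF matrix_vector_mul_linear] using D_injective by blast
qed (rule matrix_vector_mul_linear)+

text \<open>\<open>g\<close> is free, so the identity serves both the level assumed and the level to
  be proved.\<close>

lemma output_inner:
  "controlled_output A B C D ts \<mu> w t \<bullet> controlled_output A B C D ts \<mu> w t
   = stage g (state A B ts \<mu> w t) (control A B ts \<mu> w t) (w t) + g\<^sup>2 * (w t \<bullet> w t)"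
  using inner_CD[of "state A B ts \<mu> w t" "control A B ts \<mu> w t"]
  by (simp add: controlled_output_def stage_def inner_add_left inner_add_right inner_commute)

lemma state_Suc:
  "state A B ts \<mu> w (Suc t) = A *v state A B ts \<mu> w t + B *v control A B ts \<mu> w t + w t"
  by (simp add: control_def)

text \<open>Causality, by strong induction because the information reaches back to all earlier
  samples.\<close>

lemma state_cong:
  "(\<And>r. r < t \<Longrightarrow> w r = w' r) \<Longrightarrow> state A B ts \<mu> w t = state A B ts \<mu> w' t"
proof (induction t rule: less_induct)
  case (less t)
  show ?case
  proof (cases t)
    case (Suc t')
    then have "information ts (state A B ts \<mu> w) t' = information ts (state A B ts \<mu> w') t'"
      using less by (intro information_cong) auto
    then show ?thesis
      using less Suc by simp
  qed simp
qed

lemma control_cong: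
  assumes "\<And>r. r < t \<Longrightarrow> w r = w' r"
  shows "control A B ts \<mu> w t = control A B ts \<mu> w' t"
proof -
  have "information ts (state A B ts \<mu> w) t = information ts (state A B ts \<mu> w') t"
    using assms by (intro information_cong state_cong) auto
  then show ?thesis
    by (simp add: control_def)
qed

section \<open>Consequences of an achieved bound\<close>

definition running_cost ::
  "real \<Rightarrow> nat list \<Rightarrow> ('n, 'm) policy \<Rightarrow> (nat \<Rightarrow> real^'n) \<Rightarrow> nat \<Rightarrow> real"
where
  "running_cost g ts \<mu> w t = stage g (state A B ts \<mu> w t) (control A B ts \<mu> w t) (w t)"

text \<open>Whatever the policy does, the disturbance that plays \<open>L x\<close> in each of the next \<open>m\<close> steps
  secures the value of the \<open>m\<close>-step game.\<close>

lemma adversary: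
  assumes "riccati_iterate g m \<beta>"
  shows "\<exists>w'. (\<forall>r<t. w' r = w r) \<and> (\<forall>r\<ge>t + m. w' r = 0) \<and>
    \<beta> (state A B ts \<mu> w t) (state A B ts \<mu> w t) \<le> (\<Sum>k<m. running_cost g ts \<mu> w' (t + k))"
  using assms
proof (induction arbitrary: t w rule: riccati_iterate.induct)
  case zero
  show ?case
    by (intro exI[of _ "\<lambda>r. if r < t then w r else 0"]) simp
next
  case (Suc m \<beta> \<beta>' K L)
  let ?x = "state A B ts \<mu> w t" and ?u = "control A B ts \<mu> w t"
  \<comment> \<open>\<open>?x\<close> is determined by \<open>w\<close> before time
    \<open>t\<close>, so this change does not affect it.\<close>
  define w1 where "w1 = w(t := L ?x)"
  obtain w' where agree: "\<And>r. r < Suc t \<Longrightarrow> w' r = w1 r"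
    and vanish: "\<And>r. r \<ge> Suc t + m \<Longrightarrow> w' r = 0"
    and secured: "\<beta> (state A B ts \<mu> w1 (Suc t)) (state A B ts \<mu> w1 (Suc t))
      \<le> (\<Sum>k<m. running_cost g ts \<mu> w' (Suc t + k))"
    using Suc.IH[of "Suc t" w1] by blast
  have state: "state A B ts \<mu> w' t = ?x" "state A B ts \<mu> w1 t = ?x"
    and control: "control A B ts \<mu> w' t = ?u" "control A B ts \<mu> w1 t = ?u"
    using agree by (auto intro!: state_cong control_cong simp: w1_def)
  have "\<beta>' ?x ?x \<le> \<beta>' ?x ?x + deviation g \<beta> (?u - K ?x) (L ?x - L ?x)"
    using deviation_control_nonneg[OF riccati_iterate_psd[OF Suc.hyps(1)]] by simp
  also have "\<dots> = stage g ?x ?u (L ?x)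
      + \<beta> (state A B ts \<mu> w1 (Suc t)) (state A B ts \<mu> w1 (Suc t))"
    unfolding riccati_stepD(3)[OF Suc.hyps(3), symmetric] state_Suc state control
    by (simp add: w1_def)
  also have "\<dots> \<le> running_cost g ts \<mu> w' t + (\<Sum>k<m. running_cost g ts \<mu> w' (Suc t + k))"
    using secured agree[of t] by (simp add: running_cost_def state control w1_def)
  also have "\<dots> = (\<Sum>k<Suc m. running_cost g ts \<mu> w' (t + k))"
    by (subst sum.lessThan_Suc_shift) simp
  finally show ?case
    using agree vanish by (intro exI[of _ w']) (auto simp: w1_def)
qed

text \<open>A finitely supported disturbance lies in \<open>l2\<close>, and truncating the output
  drops only nonnegative terms.\<close>

lemma achieves_bound_finite_horizon:
  assumes achieves: "achieves_bound A B C D ts \<mu> \<gamma>" and w: "\<And>r. r \<ge> N \<Longrightarrow> w r = 0"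
  shows "(\<Sum>t<N. running_cost \<gamma> ts \<mu> w t) \<le> 0"
proof -
  let ?z = "controlled_output A B C D ts \<mu> w"
  have sums: "(\<lambda>t. w t \<bullet> w t) sums (\<Sum>t<N. w t \<bullet> w t)"
    using w by (intro sums_finite) auto
  then have "w \<in> l2" and w_norm: "l2_norm_sq w = (\<Sum>t<N. w t \<bullet> w t)"
    by (auto simp: l2_def l2_norm_sq_def sums_iff)
  then have z: "summable (\<lambda>t. ?z t \<bullet> ?z t)"
    and z_le: "(\<Sum>t. ?z t \<bullet> ?z t) \<le> \<gamma>\<^sup>2 * (\<Sum>t<N. w t \<bullet> w t)"
    using achieves unfolding achieves_bound_def l2_def l2_norm_sq_def by auto
  have "(\<Sum>t<N. ?z t \<bullet> ?z t) \<le> (\<Sum>t. ?z t \<bullet> ?z t)"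
    by (intro sum_le_suminf z) auto
  also note z_le
  finally show ?thesis
    unfolding output_inner[where g = \<gamma>]
    by (simp add: running_cost_def sum.distrib sum_distrib_left)
qed

text \<open>The output energy must vanish; injectivity of \<open>D\<close> then forces zero control,
  and the system never leaves \<open>0\<close>.\<close>

lemma achieves_bound_undisturbed:
  assumes "achieves_bound A B C D ts \<mu> \<gamma>"
  shows "state A B ts \<mu> (\<lambda>_. 0) t = 0" "control A B ts \<mu> (\<lambda>_. 0) t = 0"
proof -
  have control: "control A B ts \<mu> (\<lambda>_. 0) t = 0" for t
  proof -
    have "(\<Sum>t<Suc t. running_cost \<gamma> ts \<mu> (\<lambda>_. 0) t) \<le> 0"
      by (rule achieves_bound_finite_horizon[OF assms]) simp
    moreover have "0 \<le> (\<Sum>t<t. running_cost \<gamma> ts \<mu> (\<lambda>_. 0) t)"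
      by (intro sum_nonneg) (simp add: running_cost_def stage_def)
    ultimately have "running_cost \<gamma> ts \<mu> (\<lambda>_. 0) t \<le> 0"
      by simp
    then have "(D *v control A B ts \<mu> (\<lambda>_. 0) t) \<bullet> (D *v control A B ts \<mu> (\<lambda>_. 0) t) \<le> 0"
      using inner_ge_zero[of "C *v state A B ts \<mu> (\<lambda>_. 0) t"]
      unfolding running_cost_def stage_def inner_zero_left mult_zero_right by linarith
    then have "D *v control A B ts \<mu> (\<lambda>_. 0) t = 0"
      by (metis inner_eq_zero_iff inner_ge_zero antisym)
    then show ?thesis
      by (rule D_injective)
  qed
  then show "control A B ts \<mu> (\<lambda>_. 0) t = 0" .
  show "state A B ts \<mu> (\<lambda>_. 0) t = 0"
    by (induction t) (simp_all only: state_Suc control state.simps(1), simp)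
qed

text \<open>All samples before the end of the interval are \<open>0\<close>, as in the undisturbed
  run, so the controller cannot tell the two runs apart.\<close>

lemma achieves_bound_quiet_start:
  assumes achieves: "achieves_bound A B C D ts \<mu> \<gamma>"
    and s: "s = sampling_time ts l"
    and w: "\<And>r. r < s \<Longrightarrow> w r = 0"
  shows "r \<le> s \<Longrightarrow> state A B ts \<mu> w r = 0"
    and "r < s + interval ts l \<Longrightarrow> control A B ts \<mu> w r = 0"
    and "k \<le> interval ts l \<Longrightarrow> state A B ts \<mu> w (s + k) = free_response (\<lambda>k. w (s + k)) k"
proof -
  have state: "state A B ts \<mu> w r = 0" if "r \<le> s" for r
    using state_cong[of r w "\<lambda>_. 0" ts \<mu>] w that
    by (simp add: achieves_bound_undisturbed(1)[OF achieves])
  then show "r \<le> s \<Longrightarrow> state A B ts \<mu> w r = 0" .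
  have control: "control A B ts \<mu> w r = 0" if "r < s + interval ts l" for r
  proof -
    \<comment> \<open>For \<open>r < s\<close> the difference \<open>r - s\<close> is truncated, but
      then \<open>q \<le> r\<close> suffices.\<close>
    have "q \<le> s" if "sampled ts q" "q \<le> r" for q
      using sampled_le_sampling_time[OF that(1), of l "r - s"] that(2) \<open>r < s + interval ts l\<close>
      unfolding s by (cases "r < sampling_time ts l") auto
    then have "information ts (state A B ts \<mu> w) r = information ts (state A B ts \<mu> (\<lambda>_. 0)) r"
      by (auto simp: information_def fun_eq_iff state achieves_bound_undisturbed(1)[OF achieves])
    then have "control A B ts \<mu> w r = control A B ts \<mu> (\<lambda>_. 0) r"
      by (simp add: control_def)
    then show ?thesis
      by (simp add: achieves_bound_undisturbed(2)[OF achieves])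
  qed
  then show "r < s + interval ts l \<Longrightarrow> control A B ts \<mu> w r = 0" .
  show "k \<le> interval ts l \<Longrightarrow> state A B ts \<mu> w (s + k) = free_response (\<lambda>k. w (s + k)) k"
  proof (induction k)
    case 0
    then show ?case
      by (simp add: state)
  next
    case (Suc k)
    then show ?case
      unfolding add_Suc_right state_Suc by (simp add: control)
  qed
qed

text \<open>The disturbance waits for interval \<open>l\<close>, plays \<open>d\<close> during it
  and then secures \<open>\<beta>\<close> within \<open>m\<close> steps; the total cost cannot be
  positive.\<close>

lemma achieves_bound_open_loop_bound:
  assumes achieves: "achieves_bound A B C D ts \<mu> \<gamma>" and \<gamma>: "\<gamma>\<^sup>2 \<le> g\<^sup>2"
    and iterate: "riccati_iterate g m \<beta>"
  shows "open_loop_bound \<gamma> \<beta> (interval ts l)"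
  unfolding open_loop_bound_def
proof
  fix d :: "nat \<Rightarrow> real^'n"
  define h where "h = interval ts l"
  define s where "s = sampling_time ts l"
  define w where "w = (\<lambda>r. if r < s then 0 else d (r - s))"
  obtain w' where agree: "\<And>r. r < s + h \<Longrightarrow> w' r = w r"
    and vanish: "\<And>r. r \<ge> s + h + m \<Longrightarrow> w' r = 0"
    and secured: "\<beta> (state A B ts \<mu> w (s + h)) (state A B ts \<mu> w (s + h))
      \<le> (\<Sum>k<m. running_cost g ts \<mu> w' (s + h + k))"
    using adversary[OF iterate, of "s + h" w ts \<mu>] by blast
  have early: "w' r = 0" if "r < s" for r
    using agree[of r] that by (simp add: w_def)
  have late: "w' (s + k) = d k" if "k < h" for k
    using agree[of "s + k"] that by (simp add: w_def)
  note quiet = achieves_bound_quiet_start[OF achieves s_def, of w', OF early, folded h_def]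
  have state: "state A B ts \<mu> w' (s + k) = free_response d k" if "k \<le> h" for k
    using quiet(3)[OF _ that] that late free_response_cong[of k "\<lambda>k. w' (s + k)" d] by simp
  have "running_cost \<gamma> ts \<mu> w' r = 0" if "r < s" for r
    using that by (simp add: running_cost_def stage_def quiet early)
  moreover have "running_cost \<gamma> ts \<mu> w' (s + k) = stage \<gamma> (free_response d k) 0 (d k)"
    if "k < h" for k
    using that by (simp add: running_cost_def quiet(2) state late)
  ultimately have "(\<Sum>r<s + h + m. running_cost \<gamma> ts \<mu> w' r)
      = (\<Sum>k<h. stage \<gamma> (free_response d k) 0 (d k))
        + (\<Sum>k<m. running_cost \<gamma> ts \<mu> w' (s + h + k))"
    unfolding sum_lessThan_add by simp
  moreover have "(\<Sum>r<s + h + m. running_cost \<gamma> ts \<mu> w' r) \<le> 0"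
    using achieves_bound_finite_horizon[OF achieves] vanish by blast
  moreover have "(\<Sum>k<m. running_cost g ts \<mu> w' (s + h + k))
      \<le> (\<Sum>k<m. running_cost \<gamma> ts \<mu> w' (s + h + k))"
    unfolding running_cost_def by (intro sum_mono stage_antimono \<gamma>)
  moreover have "state A B ts \<mu> w (s + h) = free_response d h"
    using state_cong[of "s + h" w w' ts \<mu>] agree state[of h] by simp
  ultimately show "(\<Sum>k<interval ts l. stage \<gamma> (free_response d k) 0 (d k))
      + \<beta> (free_response d (interval ts l)) (free_response d (interval ts l)) \<le> 0"
    using secured unfolding h_def[symmetric] by simp
qed

section \<open>The predictive policy and the comparison of schedules\<close>

definition predictive_policy ::
  "(real^'n \<Rightarrow> real^'m) \<Rightarrow> (real^'n \<Rightarrow> real^'n) \<Rightarrow> ('n, 'm) policy"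
where
  "predictive_policy K F t I = (let s = Max (dom I) in K ((F ^^ (t - s)) (the (I s))))"

text \<open>The largest index in the domain of the information is the time of the newest sample,
  here the start of the interval.\<close>

lemma control_predictive_policy:
  assumes "k < interval ts l"
  shows "control A B ts (predictive_policy K F) w (sampling_time ts l + k)
    = K ((F ^^ k) (state A B ts (predictive_policy K F) w (sampling_time ts l)))"
proof -
  let ?s = "sampling_time ts l" and ?x = "state A B ts (predictive_policy K F) w"
  have sampled: "sampled ts ?s"
    by (simp add: sampled_def)
  have "Max (dom (information ts ?x (?s + k))) = ?s"
    unfolding dom_information
  proof (rule Max_eqI)
    show "r \<le> ?s" if "r \<in> {r. r \<le> ?s + k \<and> sampled ts r}" for r
      using that sampled_le_sampling_time[OF _ _ assms] by blast
  qed (use sampled in simp_all)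
  moreover have "information ts ?x (?s + k) ?s = Some (?x ?s)"
    using sampled by (simp add: information_def)
  ultimately show ?thesis
    unfolding control_def predictive_policy_def Let_def by simp
qed

text \<open>\<open>\<beta>\<close> acts as a storage function at the sampling times: the cost over
  an interval is at most its decrease, and it stays nonnegative.\<close>

lemma predictive_policy_achieves_bound:
  assumes step: "riccati_step g \<beta> \<beta> K L" and psd: "psd_form \<beta>"
    and bound: "open_loop_bound g \<beta> h"
    and ts: "schedule ts" "Max (set ts) \<le> h"
    and F: "F = (\<lambda>x. A *v x + B *v K x + L x)"
  shows "achieves_bound A B C D ts (predictive_policy K F) g"
  unfolding achieves_bound_def
proof
  fix w :: "nat \<Rightarrow> real^'n"
  assume "w \<in> l2"
  define \<mu> where "\<mu> = predictive_policy K F"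
  let ?x = "state A B ts \<mu> w" and ?z = "controlled_output A B C D ts \<mu> w"
  have cost: "(\<Sum>t<sampling_time ts l. running_cost g ts \<mu> w t)
      + \<beta> (?x (sampling_time ts l)) (?x (sampling_time ts l)) \<le> 0" for l
  proof (induction l)
    case 0
    then show ?case
      by (simp add: bilinear_lzero[OF psd_formD(1)[OF psd]])
  next
    case (Suc l)
    define s where "s = sampling_time ts l"
    define \<tau> where "\<tau> = interval ts l"
    have control: "control A B ts \<mu> w (s + k) = K ((F ^^ k) (?x s))" if "k < \<tau>" for k
      using control_predictive_policy[of k ts l K F w] that by (simp add: \<mu>_def s_def \<tau>_def)
    have "open_loop_bound g \<beta> \<tau>"
      using open_loop_bound_antimono[OF bound] interval_le_Max[OF ts(1), of l] ts(2)
      by (simp add: \<tau>_def)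
    then have "(\<Sum>k<\<tau>. stage g (?x (s + k)) (K ((F ^^ k) (?x (s + 0)))) (w (s + k)))
        + \<beta> (?x (s + \<tau>)) (?x (s + \<tau>)) \<le> \<beta> (?x (s + 0)) (?x (s + 0))"
      by (intro open_loop_play[OF step psd _ F]) (simp_all only: add_Suc_right state_Suc control add_0_right)
    then have "(\<Sum>k<\<tau>. running_cost g ts \<mu> w (s + k)) + \<beta> (?x (s + \<tau>)) (?x (s + \<tau>)) \<le> \<beta> (?x s) (?x s)"
      by (simp add: running_cost_def control)
    with Suc show ?case
      unfolding sampling_time_simps sum_lessThan_add s_def[symmetric] \<tau>_def[symmetric] by simp
  qed
  have partial: "(\<Sum>t<N. ?z t \<bullet> ?z t) \<le> g\<^sup>2 * l2_norm_sq w" for N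
  proof -
    let ?s = "sampling_time ts N"
    \<comment> \<open>The sum is extended to a sampling time, where the cost is controlled.\<close>
    have "(\<Sum>t<N. ?z t \<bullet> ?z t) \<le> (\<Sum>t<?s. ?z t \<bullet> ?z t)"
      using le_sampling_time[OF ts(1)] by (intro sum_mono2) auto
    also have "\<dots> = (\<Sum>t<?s. running_cost g ts \<mu> w t) + g\<^sup>2 * (\<Sum>t<?s. w t \<bullet> w t)"
      unfolding output_inner[where g = g] by (simp add: running_cost_def sum.distrib sum_distrib_left)
    also have "\<dots> \<le> g\<^sup>2 * (\<Sum>t<?s. w t \<bullet> w t)"
      using cost[of N] psd_formD(3)[OF psd, of "?x ?s"] by simp
    also have "\<dots> \<le> g\<^sup>2 * l2_norm_sq w"
      using \<open>w \<in> l2\<close> unfolding l2_def l2_norm_sq_def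
      by (intro mult_left_mono sum_le_suminf) auto
    finally show ?thesis .
  qed
  then have "summable (\<lambda>t. ?z t \<bullet> ?z t)"
    by (intro summableI_nonneg_bounded) auto
  with partial show "controlled_output A B C D ts (predictive_policy K F) w \<in> l2 \<and>
      l2_norm_sq (controlled_output A B C D ts (predictive_policy K F) w) \<le> g\<^sup>2 * l2_norm_sq w"
    unfolding l2_def l2_norm_sq_def \<mu>_def[symmetric] by (auto intro: suminf_le_const)
qed

text \<open>The bound forced by the longest interval of \<open>T\<close> covers every interval of
  \<open>S\<close>, and it is all that the predictive policy requires besides the fixed
  point.\<close>

lemma achieves_bound_transfer:
  assumes S: "schedule S" and T: "schedule T" and le: "Max (set S) \<le> Max (set T)"
    and achieves: "achieves_bound A B C D T \<mu> \<gamma>" and \<gamma>: "0 < \<gamma>" "\<gamma> < g"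
  shows "\<exists>\<mu>'. achieves_bound A B C D S \<mu>' g"
proof -
  have \<gamma>_le: "\<gamma>\<^sup>2 \<le> g\<^sup>2"
    using power_mono[of \<gamma> g 2] \<gamma> by simp
  obtain l where l: "interval T l = Max (set T)"
    using interval_eq_Max[OF T] .
  have bound: "open_loop_bound \<gamma> \<beta> (Max (set T))" if "riccati_iterate g m \<beta>" for m \<beta>
    using achieves_bound_open_loop_bound[OF achieves \<gamma>_le that, of l] by (simp add: l)
  have "0 < Max (set T)"
    using interval_pos[OF T, of l] by (simp add: l)
  then obtain \<beta> K L where \<beta>: "psd_form \<beta>" "riccati_step g \<beta> \<beta> K L"
    and "open_loop_bound \<gamma> \<beta> (Max (set T))"
    using riccati_fixed_point_exists[of g \<gamma> "Max (set T)"] bound \<gamma> by blast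
  then have "open_loop_bound g \<beta> (Max (set T))"
    using open_loop_bound_mono_level \<gamma>_le by blast
  then show ?thesis
    using predictive_policy_achieves_bound[OF \<beta>(2,1) _ S le refl] by blast
qed

lemma h_inf_norm_mono:
  assumes "schedule S" "schedule T" "Max (set S) \<le> Max (set T)"
  shows "h_inf_norm A B C D S \<le> h_inf_norm A B C D T"
  unfolding h_inf_norm_def[of _ _ _ _ T]
proof (rule Inf_greatest)
  fix y
  assume "y \<in> {ereal \<gamma> | \<gamma>. \<gamma> > 0 \<and> (\<exists>\<mu>. achieves_bound A B C D T \<mu> \<gamma>)}"
  then obtain \<gamma> \<mu> where y: "y = ereal \<gamma>" and \<gamma>: "0 < \<gamma>" "achieves_bound A B C D T \<mu> \<gamma>"
    by blast
  show "h_inf_norm A B C D S \<le> y"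
    unfolding y
  \<comment> \<open>A bound \<open>\<gamma>\<close> transfers only to levels above
    \<open>\<gamma>\<close>, so the infimum is approached from above.\<close>
  proof (rule dense_ge)
    fix z
    assume "ereal \<gamma> < z"
    then show "h_inf_norm A B C D S \<le> z"
    proof (cases z)
      case (real g)
      with \<open>ereal \<gamma> < z\<close> have "\<gamma> < g"
        by simp
      then have "\<exists>\<mu>'. achieves_bound A B C D S \<mu>' g" "0 < g"
        using achieves_bound_transfer[OF assms \<gamma>(2,1)] \<gamma>(1) by auto
      then show ?thesis
        unfolding h_inf_norm_def real by (intro Inf_lower) blast
    qed auto
  qed
qed

end

theorem theorem3:
  fixes A :: "real^'n^'n" and B :: "real^'m^'n"
    and C2 :: "real^'n^'p" and D21 :: "real^'m^'p"
    and ts :: "nat list"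
  assumes "transpose C2 ** D21 = 0"
    and "positive_definite (transpose D21 ** D21)"
    and "controllable A B"
    and "observable A C2"
    and "schedule ts"
  shows "h_inf_norm A B C2 D21 ts = h_inf_norm_even A B C2 D21 (Max (set ts))"
proof -
  interpret sampled_system A B C2 D21
    using assms(1,2) by unfold_locales
  have "schedule [Max (set ts)]"
    using interval_pos[OF assms(5), of 0] interval_le_Max[OF assms(5), of 0]
    by (simp add: schedule_def)
  \<comment> \<open>Both schedules have the same longest interval, so monotonicity applies in both
    directions.\<close>
  then show ?thesis
    using assms(5) unfolding h_inf_norm_even_def by (intro antisym h_inf_norm_mono) auto
qed

end
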